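(* Let $\varepsilon\in(0,1)$, let $\sigma^2\ge 0$, and let $\mathcal{P}$ be the set of all probability distributions on $\mathbb{R}$ with mean $\mu=0$ and variance $\sigma^2$. Then, for the scalar random variable $\xi\in\mathbb{R}$, $$\sup_{\mathbb{P}\in\mathcal{P}}\mathbb{P}\text{-CVaR}_{\varepsilon}[\xi]=\sup_{\mathbb{P}\in\mathcal{P}}\mathbb{P}\text{-CVaR}_{\varepsilon}[-\xi]\ge 0.$$
   Context: For a measurable loss function $L:\mathbb{R}\to\mathbb{R}$, a probability distribution $\mathbb{P}$ on $\mathbb{R}$ (the law of $\xi$) and a level $\varepsilon\in(0,1)$, the Conditional Value-at-Risk is $$\mathbb{P}\text{-CVaR}_{\varepsilon}[L(\xi)]=\inf_{\beta\in\mathbb{R}}\left\{\beta+\frac1\varepsilon\,\mathbb{E}_{\mathbb{P}}\big[(L(\xi)-\beta)^+\big]\right\},$$ where $(a)^+=\max(a,0)$. The worst-case CVaR over $\mathcal{P}$ is the supremum of this quantity over $\mathbb{P}\in\mathcal{P}$. *)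

theory Defs
  imports "HOL-Probability.Probability"
begin

(* The expectation of the nonnegative variable (L - b)^+ is a Lebesgue integral with values in
   [0, \<infinity>], and the infimum is taken in the extended reals, so the formula makes sense for
   every measurable L, integrable or not. *)
definition cvar :: "real measure \<Rightarrow> real \<Rightarrow> (real \<Rightarrow> real) \<Rightarrow> ereal" where
  "cvar P \<epsilon> L = (INF \<beta>::real. ereal \<beta> +
     ereal (1 / \<epsilon>) * enn2ereal (\<integral>\<^sup>+ \<xi>. ennreal (max (L \<xi> - \<beta>) 0) \<partial>P))"

definition worst_case_cvar :: "real measure set \<Rightarrow> real \<Rightarrow> (real \<Rightarrow> real) \<Rightarrow> ereal" where
  "worst_case_cvar \<P> \<epsilon> L = (SUP P\<in>\<P>. cvar P \<epsilon> L)"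

(* The Bochner integral of a non-integrable function is 0, so existence of the first two moments
   has to be required explicitly. *)
definition distributions_mean_var :: "real \<Rightarrow> real \<Rightarrow> real measure set" where
  "distributions_mean_var \<mu> v =
     {P. real_distribution P \<and>
         integrable P (\<lambda>x. x) \<and> integrable P (\<lambda>x. x\<^sup>2) \<and>
         prob_space.expectation P (\<lambda>x. x) = \<mu> \<and>
         prob_space.variance P (\<lambda>x. x) = v}"

end

theory Submission
  imports Defs
begin

text \<open>Reflection at the origin maps the distributions with mean zero and a given variance onto
  themselves and exchanges the losses \<open>\<xi>\<close> and \<open>- \<xi>\<close>. Moreover CVaR dominates the expectation,
  because \<open>\<beta> + (x - \<beta>)\<^sup>+ / \<epsilon> \<ge> x\<close> for \<open>\<epsilon> \<le> 1\<close>, and the ambiguity set contains the uniform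
  distribution on the two points \<open>\<plusminus>\<sigma>\<close>.\<close>

lemma cvar_distr:
  assumes [measurable]: "f \<in> M \<rightarrow>\<^sub>M borel" "L \<in> borel_measurable borel"
  shows "cvar (distr M borel f) \<epsilon> L = cvar M \<epsilon> (\<lambda>x. L (f x))"
  unfolding cvar_def by (subst nn_integral_distr) auto

text \<open>The bound holds for each \<beta> separately: E X - \<beta> \<le> E (X - \<beta>)^+ by
  monotonicity of the integral, and the factor 1/\<epsilon> \<ge> 1 only enlarges the right-hand
  side.\<close>

lemma expectation_le_cvar:
  assumes "prob_space M" and "0 < \<epsilon>" "\<epsilon> \<le> 1" and X: "integrable M X"
  shows "ereal (\<integral>x. X x \<partial>M) \<le> cvar M \<epsilon> X"
proof -
  interpret prob_space M by fact
  show ?thesis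
    unfolding cvar_def
  proof (rule INF_greatest)
    fix \<beta> :: real
    have int: "integrable M (\<lambda>x. max (X x - \<beta>) 0)"
      using X by (intro integrable_max) auto
    define e where "e = expectation (\<lambda>x. max (X x - \<beta>) 0)"
    have e0: "0 \<le> e"
      unfolding e_def by (intro integral_nonneg_AE) auto
    have "expectation (\<lambda>x. X x - \<beta>) \<le> e"
      unfolding e_def using X int by (intro integral_mono) auto
    hence "expectation X \<le> \<beta> + e"
      using X by (simp add: prob_space)
    moreover have "1 * e \<le> 1 / \<epsilon> * e"
      using e0 assms(2,3) by (intro mult_right_mono) auto
    ultimately have "expectation X \<le> \<beta> + 1 / \<epsilon> * e"
      by linarith
    \<comment> \<open>Integrability makes the extended nonnegative integral finite, so the
      \<open>ereal\<close> goal reduces to the real inequality just obtained.\<close>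
    moreover have "(\<integral>\<^sup>+ x. ennreal (max (X x - \<beta>) 0) \<partial>M) = ennreal e"
      unfolding e_def using int by (intro nn_integral_eq_integral) auto
    ultimately show "ereal (\<integral>x. X x \<partial>M) \<le> ereal \<beta> +
        ereal (1 / \<epsilon>) * enn2ereal (\<integral>\<^sup>+ x. ennreal (max (X x - \<beta>) 0) \<partial>M)"
      using e0 by simp
  qed
qed

lemma distr_uminus_mem_distributions_mean_var:
  assumes "P \<in> distributions_mean_var \<mu> v"
  shows "distr P borel uminus \<in> distributions_mean_var (- \<mu>) v"
proof -
  from assms have "real_distribution P" and int: "integrable P (\<lambda>x. x)" "integrable P (\<lambda>x. x\<^sup>2)"
    and mean: "(\<integral>x. x \<partial>P) = \<mu>" and var: "(\<integral>x. (x - \<mu>)\<^sup>2 \<partial>P) = v"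
    by (auto simp: distributions_mean_var_def)
  then interpret real_distribution P by simp
  have [measurable]: "(uminus :: real \<Rightarrow> real) \<in> P \<rightarrow>\<^sub>M borel"
    by simp
  have mean': "(\<integral>x. x \<partial>distr P borel uminus) = - \<mu>"
    using mean by (subst integral_distr) auto
  \<comment> \<open>After the change of variables the integrand is (-x - (-\<mu>))^2 = (x -
    \<mu>)^2.\<close>
  have var': "(\<integral>x. (x - - \<mu>)\<^sup>2 \<partial>distr P borel uminus) = v"
    using var by (subst integral_distr) (auto simp: power2_commute)
  have int1: "integrable (distr P borel uminus) (\<lambda>x. x)"
    by (subst integrable_distr_eq) (measurable, rule integrable_minus [OF int(1)])
  have int2: "integrable (distr P borel uminus) (\<lambda>x. x\<^sup>2)"
    by (subst integrable_distr_eq) (measurable, simp only: power2_minus int(2))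
  have "real_distribution (distr P borel uminus)"
    by (rule real_distribution_distr) measurable
  then show ?thesis
    unfolding distributions_mean_var_def
    by (simp only: mem_Collect_eq mean' var' int1 int2 simp_thms)
qed

text \<open>Each P is matched with its reflection, which has the same CVaR by change of variables.
  One inequality for arbitrary \<open>L\<close> suffices: replacing \<open>L\<close> by its
  reflection gives the converse.\<close>

lemma worst_case_cvar_uminus_le:
  assumes [measurable]: "L \<in> borel_measurable borel"
  shows "worst_case_cvar (distributions_mean_var \<mu> v) \<epsilon> (\<lambda>x. L (- x))
       \<le> worst_case_cvar (distributions_mean_var (- \<mu>) v) \<epsilon> L"
  unfolding worst_case_cvar_def
proof (rule SUP_mono)
  fix P assume P: "P \<in> distributions_mean_var \<mu> v"
  then have "real_distribution P"
    by (simp add: distributions_mean_var_def)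
  then interpret real_distribution P .
  have "cvar P \<epsilon> (\<lambda>x. L (- x)) = cvar (distr P borel uminus) \<epsilon> L"
    by (rule cvar_distr [symmetric]) auto
  with distr_uminus_mem_distributions_mean_var [OF P]
  show "\<exists>Q\<in>distributions_mean_var (- \<mu>) v. cvar P \<epsilon> (\<lambda>x. L (- x)) \<le> cvar Q \<epsilon> L"
    by auto
qed

text \<open>Needed for the lower bound: over an empty set the supremum in \<open>ereal\<close> would
  be -\<infinity>.\<close>

lemma distributions_mean_var_nonempty:
  assumes "0 \<le> v"
  shows "distributions_mean_var \<mu> v \<noteq> {}"
proof -
  \<comment> \<open>A fair coin pushed forward along \<open>f\<close> puts mass 1/2 on each of \<mu>
    + sqrt v and \<mu> - sqrt v; for v = 0 this is the point mass at \<mu>.\<close>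
  define B where "B = measure_pmf (bernoulli_pmf (1/2))"
  define f where "f = (\<lambda>b. if b then \<mu> + sqrt v else \<mu> - sqrt v)"
  interpret B: prob_space B
    unfolding B_def by (rule prob_space_measure_pmf)
  have [measurable]: "f \<in> B \<rightarrow>\<^sub>M borel"
    by (simp add: B_def)
  have int: "integrable B g" for g :: "bool \<Rightarrow> real"
    unfolding B_def by (rule integrable_measure_pmf_finite) simp
  have E: "(\<integral>b. g b \<partial>B) = (g True + g False) / 2" for g :: "bool \<Rightarrow> real"
    unfolding B_def by (simp add: field_simps)
  have E': "(\<integral>x. g x \<partial>distr B borel f) = (g (\<mu> + sqrt v) + g (\<mu> - sqrt v)) / 2"
    if "g \<in> borel_measurable borel" for g :: "real \<Rightarrow> real"
    using that by (subst integral_distr) (simp_all add: E, simp add: f_def)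
  have int': "integrable (distr B borel f) g"
    if "g \<in> borel_measurable borel" for g :: "real \<Rightarrow> real"
    using that by (subst integrable_distr_eq) (auto intro: int)
  have mean: "(\<integral>x. x \<partial>distr B borel f) = \<mu>"
    by (subst E') auto
  \<comment> \<open>Both atoms have squared deviation (sqrt v)^2, which equals v because v \<ge>
    0.\<close>
  have "(\<integral>x. (x - \<mu>)\<^sup>2 \<partial>distr B borel f) = v"
    using assms by (subst E') auto
  then have "distr B borel f \<in> distributions_mean_var \<mu> v"
    unfolding distributions_mean_var_def using mean
    by (auto intro!: int' B.real_distribution_distr)
  then show ?thesis
    by blast
qed

theorem mainTheorem2:
  fixes \<epsilon> \<sigma>2 :: real
  assumes "0 < \<epsilon>" and "\<epsilon> < 1" and "0 \<le> \<sigma>2"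
  shows "worst_case_cvar (distributions_mean_var 0 \<sigma>2) \<epsilon> (\<lambda>\<xi>. \<xi>)
           = worst_case_cvar (distributions_mean_var 0 \<sigma>2) \<epsilon> (\<lambda>\<xi>. - \<xi>)
       \<and> worst_case_cvar (distributions_mean_var 0 \<sigma>2) \<epsilon> (\<lambda>\<xi>. - \<xi>) \<ge> 0"
proof
  show "worst_case_cvar (distributions_mean_var 0 \<sigma>2) \<epsilon> (\<lambda>\<xi>. \<xi>)
      = worst_case_cvar (distributions_mean_var 0 \<sigma>2) \<epsilon> (\<lambda>\<xi>. - \<xi>)"
    \<comment> \<open>The two instances give the two inequalities, since - (- x) = x and the
      reflected mean - 0 is again 0.\<close>
    using worst_case_cvar_uminus_le [of "\<lambda>x. x" 0 \<sigma>2 \<epsilon>]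
      worst_case_cvar_uminus_le [of "\<lambda>x. - x" 0 \<sigma>2 \<epsilon>]
    by (intro antisym) auto
next
  obtain P where P: "P \<in> distributions_mean_var 0 \<sigma>2"
    using distributions_mean_var_nonempty [OF assms(3)] by blast
  then have "real_distribution P" and int: "integrable P (\<lambda>x. x)" and mean: "(\<integral>x. x \<partial>P) = 0"
    by (auto simp: distributions_mean_var_def)
  then interpret real_distribution P by simp
  \<comment> \<open>Any member of the ambiguity set serves here, as the mean of -\<xi> is 0 under
    each of them.\<close>
  have "ereal (expectation (\<lambda>x. - x)) \<le> cvar P \<epsilon> (\<lambda>x. - x)"
    using assms int by (intro expectation_le_cvar prob_space_axioms) auto
  then have "0 \<le> cvar P \<epsilon> (\<lambda>x. - x)"
    by (simp add: mean zero_ereal_def)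
  also have "\<dots> \<le> worst_case_cvar (distributions_mean_var 0 \<sigma>2) \<epsilon> (\<lambda>\<xi>. - \<xi>)"
    unfolding worst_case_cvar_def using P by (rule SUP_upper)
  finally show "0 \<le> worst_case_cvar (distributions_mean_var 0 \<sigma>2) \<epsilon> (\<lambda>\<xi>. - \<xi>)" .
qed

end
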